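(* Let $G$ be a finite additive abelian group and let $N=\bigoplus_{g\in G}N_g$ be a $G$-graded Novikov algebra over a field $K$ whose $0$-component $N_0$ is solvable. If the characteristic of $K$ does not divide the order of $G$, then $N$ is solvable.
   Context: A (nonassociative) algebra $N$ over a field $K$ is a Novikov algebra if $(x,y,z)=(y,x,z)$ and $(xy)z=(xz)y$ for all $x,y,z\in N$, where $(x,y,z)=(xy)z-x(yz)$. For subspaces $U,V$, the product $UV$ is the linear span of all $uv$ with $u\in U$, $v\in V$. $N=\bigoplus_{g\in G}N_g$ (direct sum of subspaces) is $G$-graded if $N_gN_h\subseteq N_{g+h}$ for all $g,h\in G$. The derived powers of an algebra $A$ are $A^{(0)}=A$, $A^{(m)}=A^{(m-1)}A^{(m-1)}$ for $m\ge 1$; $A$ is solvable if $A^{(m)}=0$ for some positive integer $m$. The condition that the characteristic of $K$ does not divide $|G|$ means that the characteristic is $0$ or a prime $p$ not dividing $|G|$. *)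

theory Defs
  imports Complex_Main "HOL-Library.Cardinality"
begin

locale nonassoc_algebra = vector_space scale
  for scale :: "'k::field \<Rightarrow> 'n::ab_group_add \<Rightarrow> 'n" (infixr \<open>*s\<close> 75) +
  fixes mult :: "'n \<Rightarrow> 'n \<Rightarrow> 'n" (infixl \<open>\<cdot>\<close> 70)
  assumes linear_mult_right: "Vector_Spaces.linear scale scale (\<lambda>y. x \<cdot> y)"
    and linear_mult_left: "Vector_Spaces.linear scale scale (\<lambda>x. x \<cdot> y)"
begin

definition associator :: "'n \<Rightarrow> 'n \<Rightarrow> 'n \<Rightarrow> 'n" where
  "associator x y z = (x \<cdot> y) \<cdot> z - x \<cdot> (y \<cdot> z)"

definition subspace_mult :: "'n set \<Rightarrow> 'n set \<Rightarrow> 'n set" where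
  "subspace_mult U V = span {u \<cdot> v | u v. u \<in> U \<and> v \<in> V}"

text \<open>The following two notions are applied to subalgebras (such as the zero component of a
  grading); derived powers of a subalgebra do not depend on the ambient algebra.\<close>

primrec derived_power :: "'n set \<Rightarrow> nat \<Rightarrow> 'n set" where
  "derived_power A 0 = A"
| "derived_power A (Suc m) = subspace_mult (derived_power A m) (derived_power A m)"

definition solvable :: "'n set \<Rightarrow> bool" where
  "solvable A \<longleftrightarrow> (\<exists>m>0. derived_power A m = {0})"

end

locale novikov_algebra = nonassoc_algebra +
  assumes left_symmetric: "associator x y z = associator y x z"
    and right_commutative: "(x \<cdot> y) \<cdot> z = (x \<cdot> z) \<cdot> y"

text \<open>The grading group is finite, so a direct sum decomposition says that every vector is, in
  exactly one way, a sum over the whole group of one vector from each component.\<close>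

locale graded_algebra = nonassoc_algebra scale mult
  for scale :: "'k::field \<Rightarrow> 'n::ab_group_add \<Rightarrow> 'n" (infixr \<open>*s\<close> 75)
    and mult :: "'n \<Rightarrow> 'n \<Rightarrow> 'n" (infixl \<open>\<cdot>\<close> 70) +
  fixes component :: "'g::{finite, ab_group_add} \<Rightarrow> 'n set"
  assumes subspace_component: "subspace (component g)"
    and direct_sum: "\<exists>!f. (\<forall>g. f g \<in> component g) \<and> x = (\<Sum>g\<in>UNIV. f g)"
    and graded_mult: "subspace_mult (component g) (component h) \<subseteq> component (g + h)"

end

theory Submission
  imports Defs
begin

text \<open>
  Write \<open>R\<^sub>a\<close> for right multiplication by \<open>a\<close>. Right commutativity says that these operators
  commute, and with it left symmetry becomes a product rule: for lists \<open>Y\<close>, \<open>Z\<close> of right factors,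
  \[ R_{xYZ} = R_{xY} R_Z + R_{xZ} R_Y - R_x R_Y R_Z. \]
  (In the model \<open>x \<cdot> y = x * d y\<close>, with \<open>d\<close> a derivation of a commutative algebra, \<open>R\<^sub>a\<close> is
  multiplication by \<open>d a\<close> and this is the Leibniz rule.) This is lemma \<open>mult_right_mults_append\<close>.

  Call a set \<open>S\<close> right nil if, for some \<open>k\<close>, any \<open>k\<close> operators \<open>R\<^sub>s\<close> with \<open>s \<in> S\<close> have product
  \<open>0\<close> on the whole algebra. As right multiplications commute, right nilness passes from \<open>S\<close> to
  \<open>T\<close> as soon as all sufficiently long products of operators \<open>R\<^sub>t\<close> with \<open>t \<in> T\<close> lie in the ideal
  generated by the \<open>R\<^sub>s\<close> (lemma \<open>right_nil_transfer\<close>). The product rule supplies such products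
  twice.

  \<^item> For a subalgebra \<open>B\<close> and \<open>x, y, z \<in> B\<close>, the rule with \<open>Y = [y]\<close> and \<open>Z = [z]\<close> expresses
    \<open>R\<^sub>x R\<^sub>y R\<^sub>z\<close> through right multiplications by elements of \<open>B B\<close>. Descending the derived
    series, a solvable subalgebra is right nil, even as it acts on the whole algebra
    (lemma \<open>right_nil_of_derived_power\<close>). In particular \<open>N\<^sub>0\<close> is right nil.

  \<^item> Let \<open>n\<close> be the order of \<open>G\<close>. Take \<open>x\<close> and a list of \<open>n\<^sup>2 - 1\<close> right factors in \<open>N\<^sub>g\<close>, and cut
    the list into \<open>n + 1\<close> blocks \<open>Y\<^sub>i\<close> of length \<open>n - 1\<close>. Every \<open>x Y\<^sub>i\<close>, and also \<open>x\<close> times the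
    whole list, is a product of a multiple of \<open>n\<close> elements of degree \<open>g\<close> and so lies in \<open>N\<^sub>0\<close>. The
    product rule, iterated over the blocks, leaves \<open>n\<close> times the product of all \<open>n\<^sup>2\<close> right
    multiplications in the ideal generated by the \<open>R\<^sub>s\<close> with \<open>s \<in> N\<^sub>0\<close>. As \<open>n\<close> is invertible in
    the field, \<open>N\<^sub>g\<close> is right nil.

  Finite unions and linear spans of right nil sets are right nil, so the whole algebra is right
  nil. Since \<open>A\<^sup>(\<^sup>m\<^sup>+\<^sup>1\<^sup>)\<close> is contained in the span of the products of an element of \<open>A\<^sup>(\<^sup>m\<^sup>)\<close>
  with one more right factor, it is solvable.
\<close>

section \<open>Iterated right multiplication\<close>

context nonassoc_algebra
begin

abbreviation right_mults :: "'n \<Rightarrow> 'n list \<Rightarrow> 'n" (infixl \<open>\<odot>\<close> 70) where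
  "v \<odot> ys \<equiv> foldl (\<cdot>) v ys"

lemma mult_distribs:
  "x \<cdot> (y + z) = x \<cdot> y + x \<cdot> z" "(x + y) \<cdot> z = x \<cdot> z + y \<cdot> z"
  "x \<cdot> (y - z) = x \<cdot> y - x \<cdot> z" "(x - y) \<cdot> z = x \<cdot> z - y \<cdot> z"
proof -
  interpret left: Vector_Spaces.linear scale scale "\<lambda>y. x \<cdot> y" for x
    by (rule linear_mult_right)
  interpret right: Vector_Spaces.linear scale scale "\<lambda>x. x \<cdot> y" for y
    by (rule linear_mult_left)
  show "x \<cdot> (y + z) = x \<cdot> y + x \<cdot> z" "(x + y) \<cdot> z = x \<cdot> z + y \<cdot> z"
    "x \<cdot> (y - z) = x \<cdot> y - x \<cdot> z" "(x - y) \<cdot> z = x \<cdot> z - y \<cdot> z"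
    by (rule left.add right.add left.diff right.diff)+
qed

lemma mult_scale: "x \<cdot> (c *s y) = c *s (x \<cdot> y)" "(c *s x) \<cdot> y = c *s (x \<cdot> y)"
proof -
  interpret left: Vector_Spaces.linear scale scale "\<lambda>y. x \<cdot> y" for x
    by (rule linear_mult_right)
  interpret right: Vector_Spaces.linear scale scale "\<lambda>x. x \<cdot> y" for y
    by (rule linear_mult_left)
  show "x \<cdot> (c *s y) = c *s (x \<cdot> y)" "(c *s x) \<cdot> y = c *s (x \<cdot> y)"
    by (rule left.scale right.scale)+
qed

lemma mult_zero [simp]: "x \<cdot> 0 = 0" "0 \<cdot> x = 0"
  using mult_distribs(3)[of x 0 0] mult_distribs(4)[of 0 0 x] by simp_all

lemma zero_right_mults [simp]: "0 \<odot> ys = 0"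
  by (induction ys) simp_all

lemma right_mults_add: "(u + v) \<odot> ys = u \<odot> ys + v \<odot> ys"
  by (induction ys arbitrary: u v) (simp_all add: mult_distribs)

lemma right_mults_diff: "(u - v) \<odot> ys = u \<odot> ys - v \<odot> ys"
  by (induction ys arbitrary: u v) (simp_all add: mult_distribs)

lemma right_mults_scale: "(c *s v) \<odot> ys = c *s (v \<odot> ys)"
  by (induction ys arbitrary: v) (simp_all add: mult_scale)

text \<open>
  The operators act on the whole algebra, not just on \<open>S\<close>: for a component of a grading this is
  what allows right nilness to be carried from one component to another.
\<close>

definition right_nil :: "nat \<Rightarrow> 'n set \<Rightarrow> bool" where
  "right_nil k S \<longleftrightarrow> (\<forall>v ys. set ys \<subseteq> S \<and> length ys = k \<longrightarrow> v \<odot> ys = 0)"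

lemma right_nilD: "right_nil k S \<Longrightarrow> set ys \<subseteq> S \<Longrightarrow> k \<le> length ys \<Longrightarrow> v \<odot> ys = 0"
proof -
  assume *: "right_nil k S" "set ys \<subseteq> S" "k \<le> length ys"
  have "v \<odot> ys = (v \<odot> take k ys) \<odot> drop k ys"
    by (metis append_take_drop_id foldl_append)
  also have "v \<odot> take k ys = 0"
    using * set_take_subset[of k ys] unfolding right_nil_def
    by (metis length_take min.absorb2 subset_trans)
  finally show ?thesis by simp
qed

text \<open>
  For \<open>s \<in> S\<close> the operators \<open>R\<^sub>s\<close> followed by arbitrary right multiplications span the ideal
  generated by the \<open>R\<^sub>s\<close>; this is the image of \<open>v\<close> under that ideal.
\<close>

definition right_ideal_of :: "'n \<Rightarrow> 'n set \<Rightarrow> 'n set" where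
  "right_ideal_of v S = span {(v \<cdot> s) \<odot> zs | s zs. s \<in> S}"

lemma subspace_right_ideal_of: "subspace (right_ideal_of v S)"
  unfolding right_ideal_of_def by (rule subspace_span)

lemma right_ideal_of_generator: "s \<in> S \<Longrightarrow> (v \<cdot> s) \<odot> zs \<in> right_ideal_of v S"
  unfolding right_ideal_of_def by (blast intro: span_base)

lemma right_ideal_of_generator': "s \<in> S \<Longrightarrow> v \<cdot> s \<in> right_ideal_of v S"
  using right_ideal_of_generator[of s S v "[]"] by simp

lemma right_ideal_of_closed:
  assumes "w \<in> right_ideal_of v S"
  shows "w \<odot> ys \<in> right_ideal_of v S"
  using assms unfolding right_ideal_of_def
proof (induction rule: span_induct_alt)
  case base
  show ?case by (simp add: span_zero)
next
  case (step c x y)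
  then obtain s zs where "x = (v \<cdot> s) \<odot> zs" "s \<in> S" by blast
  then have "x \<odot> ys = (v \<cdot> s) \<odot> (zs @ ys)" by simp
  with \<open>s \<in> S\<close> have "x \<odot> ys \<in> span {(v \<cdot> s) \<odot> zs | s zs. s \<in> S}"
    by (blast intro: span_base)
  with step.IH show ?case
    by (simp add: right_mults_add right_mults_scale span_add span_scale)
qed

text \<open>Each derived power puts one more factor on the right of the previous one.\<close>

lemma solvable_if_right_nil:
  assumes "right_nil k UNIV"
  shows "solvable UNIV"
proof -
  have sub: "derived_power UNIV m \<subseteq> span {v \<odot> ys | v ys. length ys = m}" for m
  proof (induction m)
    case 0
    show ?case by (force intro: span_base)
  next
    case (Suc m)
    let ?M = "\<lambda>m. {v \<odot> ys | v ys. length ys = m}"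
    have "x \<cdot> y \<in> span (?M (Suc m))" if "x \<in> span (?M m)" for x y
      using that
    proof (induction rule: span_induct_alt)
      case base
      show ?case by (simp add: span_zero)
    next
      case (step c u w)
      then obtain v ys where "u = v \<odot> ys" "length ys = m" by blast
      then have "u \<cdot> y = v \<odot> (ys @ [y])" "length (ys @ [y]) = Suc m" by simp_all
      then have "u \<cdot> y \<in> span (?M (Suc m))" by (blast intro: span_base)
      with step.IH show ?case
        by (simp add: mult_distribs mult_scale span_add span_scale)
    qed
    with Suc have "{u \<cdot> v | u v. u \<in> derived_power UNIV m \<and> v \<in> derived_power UNIV m}
        \<subseteq> span (?M (Suc m))"
      by blast
    then show ?case
      by (simp add: subspace_mult_def span_minimal)
  qed
  have "{v \<odot> ys | v ys. length ys = Suc k} \<subseteq> {0}"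
    using right_nilD[OF assms] by auto
  then have "derived_power UNIV (Suc k) \<subseteq> {0}"
    using sub[of "Suc k"] span_minimal[of _ "{0}"] subspace_single_0 by blast
  moreover have "0 \<in> derived_power UNIV (Suc k)"
    by (simp add: subspace_mult_def span_zero)
  ultimately show ?thesis
    unfolding solvable_def by blast
qed

lemma derived_power_Suc_left:
  "derived_power A (Suc m) = derived_power (subspace_mult A A) m"
  by (induction m) simp_all

end

section \<open>The product rule for right multiplications\<close>

context novikov_algebra
begin

lemma right_mults_mult_commute: "(v \<cdot> y) \<odot> zs = (v \<odot> zs) \<cdot> y"
  by (induction zs arbitrary: v) (simp_all add: right_commutative)

lemma right_mults_commute: "(v \<odot> ys) \<odot> zs = (v \<odot> zs) \<odot> ys"
  by (induction ys arbitrary: v) (simp_all add: right_mults_mult_commute)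

lemma mult_right_mults_mult:
  "v \<cdot> ((x \<odot> ys) \<cdot> z) = (v \<cdot> (x \<odot> ys)) \<cdot> z + (v \<cdot> (x \<cdot> z)) \<odot> ys - ((v \<cdot> x) \<cdot> z) \<odot> ys"
proof -
  let ?u = "x \<odot> ys"
  \<comment> \<open>Left multiplication by \<open>x \<odot> ys\<close> is left multiplication by \<open>x\<close> followed by the \<open>ys\<close>, so the
    factors \<open>ys\<close> can be pulled out of an associator in its first argument.\<close>
  have "associator v ?u z = (?u \<cdot> v) \<cdot> z - ?u \<cdot> (v \<cdot> z)"
    unfolding left_symmetric[of v] by (simp add: associator_def)
  also have "\<dots> = associator x v z \<odot> ys"
    by (simp add: associator_def right_mults_diff right_mults_mult_commute)
  also have "\<dots> = associator v x z \<odot> ys"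
    by (simp add: left_symmetric)
  finally show ?thesis
    by (simp add: associator_def right_mults_diff algebra_simps)
qed

text \<open>
  The difference \<open>R\<^bsub>xY\<^esub> - R\<^sub>x R\<^sub>Y\<close> is the commutator of \<open>R\<^sub>Y\<close> with left multiplication by \<open>x\<close>:
  for a single factor this is left symmetry. Commutators obey the Leibniz rule, which for the
  concatenation of two lists gives the identity below.
\<close>

lemma mult_right_mults_append:
  "v \<cdot> (x \<odot> (ys @ zs)) =
    (v \<cdot> (x \<odot> ys)) \<odot> zs + (v \<cdot> (x \<odot> zs)) \<odot> ys - (v \<cdot> x) \<odot> (ys @ zs)"
proof (induction zs rule: rev_induct)
  case Nil
  show ?case by simp
next
  case (snoc z zs)
  have "v \<cdot> (x \<odot> (ys @ zs @ [z])) = v \<cdot> ((x \<odot> (ys @ zs)) \<cdot> z)"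
    by simp
  also have "\<dots> = (v \<cdot> (x \<odot> (ys @ zs))) \<cdot> z + (v \<cdot> (x \<cdot> z)) \<odot> (ys @ zs)
      - ((v \<cdot> x) \<cdot> z) \<odot> (ys @ zs)"
    by (rule mult_right_mults_mult)
  also have "\<dots> = (v \<cdot> (x \<odot> ys)) \<odot> (zs @ [z])
      + ((v \<cdot> (x \<odot> zs)) \<cdot> z + (v \<cdot> (x \<cdot> z)) \<odot> zs - ((v \<cdot> x) \<cdot> z) \<odot> zs) \<odot> ys
      - (v \<cdot> x) \<odot> (ys @ zs @ [z])"
    unfolding snoc.IH
    by (simp add: right_mults_add right_mults_diff mult_distribs right_mults_mult_commute
        right_mults_commute[of _ zs ys] algebra_simps)
  also have "(v \<cdot> (x \<odot> zs)) \<cdot> z + (v \<cdot> (x \<cdot> z)) \<odot> zs - ((v \<cdot> x) \<cdot> z) \<odot> zs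
      = v \<cdot> (x \<odot> (zs @ [z]))"
    using mult_right_mults_mult[of v x zs z] by simp
  finally show ?case .
qed

section \<open>Transfer of right nilness\<close>

text \<open>
  Let \<open>J\<close> be the ideal generated by the \<open>R\<^sub>s\<close> with \<open>s \<in> S\<close>. The hypothesis puts products of \<open>l\<close>
  right multiplications from \<open>T\<close> in \<open>J\<close>, hence products of \<open>j * l\<close> of them in \<open>J\<^sup>j\<close>; and \<open>J\<^sup>k = 0\<close>
  because right multiplications commute.
\<close>

lemma right_nil_transfer:
  assumes nil: "right_nil k S"
    and gen: "\<And>v ys. set ys \<subseteq> T \<Longrightarrow> length ys = l \<Longrightarrow> v \<odot> ys \<in> right_ideal_of v S"
  shows "right_nil (k * l) T"
proof -
  let ?M = "\<lambda>j. {v \<odot> ys | v ys. set ys \<subseteq> S \<and> length ys = j}"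
  have step: "right_ideal_of v S \<subseteq> span (?M (Suc j))" if "v \<in> span (?M j)" for v j
  proof -
    have "(v \<cdot> s) \<odot> zs \<in> span (?M (Suc j))" if "s \<in> S" for s zs
      using \<open>v \<in> span (?M j)\<close>
    proof (induction rule: span_induct_alt)
      case base
      show ?case by (simp add: span_zero)
    next
      case (step c u w)
      then obtain v ys where u: "u = v \<odot> ys" "set ys \<subseteq> S" "length ys = j" by blast
      then have "(u \<cdot> s) \<odot> zs = (v \<odot> zs) \<odot> (ys @ [s])"
        by (simp add: right_mults_mult_commute right_mults_commute[of v ys zs])
      moreover have "set (ys @ [s]) \<subseteq> S" "length (ys @ [s]) = Suc j"
        using u \<open>s \<in> S\<close> by simp_all
      ultimately have "(u \<cdot> s) \<odot> zs \<in> span (?M (Suc j))" by (blast intro: span_base)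
      with step.IH show ?case
        by (simp add: mult_distribs mult_scale right_mults_add right_mults_scale
            span_add span_scale)
    qed
    then show ?thesis
      unfolding right_ideal_of_def by (intro span_minimal subspace_span) auto
  qed
  have iter: "v \<odot> ys \<in> span (?M j)" if "set ys \<subseteq> T" "length ys = j * l" for v ys j
    using that
  proof (induction j arbitrary: ys)
    case 0
    then show ?case by (force intro: span_base)
  next
    case (Suc j)
    let ?ys1 = "take (j * l) ys" and ?ys2 = "drop (j * l) ys"
    have "v \<odot> ?ys1 \<in> span (?M j)"
      using Suc.prems set_take_subset[of "j * l" ys] by (intro Suc.IH) auto
    moreover have "(v \<odot> ?ys1) \<odot> ?ys2 \<in> right_ideal_of (v \<odot> ?ys1) S"
      using Suc.prems set_drop_subset[of "j * l" ys] by (intro gen) auto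
    ultimately have "(v \<odot> ?ys1) \<odot> ?ys2 \<in> span (?M (Suc j))"
      using step by blast
    then show ?case
      by (metis append_take_drop_id foldl_append)
  qed
  have "?M k \<subseteq> {0}"
    using nil by (auto simp: right_nil_def)
  then have "span (?M k) \<subseteq> {0}"
    by (intro span_minimal) simp_all
  with iter show ?thesis
    unfolding right_nil_def by blast
qed

lemma right_nil_span:
  assumes "right_nil k S"
  shows "right_nil k (span S)"
proof -
  have "v \<cdot> y \<in> right_ideal_of v S" if "y \<in> span S" for v y
    using that
  proof (induction rule: span_induct_alt)
    case base
    show ?case using subspace_0[OF subspace_right_ideal_of] by simp
  next
    case (step c x y)
    then show ?case
      using right_ideal_of_generator'[of x S v] subspace_right_ideal_of[of v S]
      by (simp add: mult_distribs mult_scale subspace_add subspace_scale)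
  qed
  then have "right_nil (k * 1) (span S)"
    by (intro right_nil_transfer[OF assms]) (auto simp: length_Suc_conv)
  then show ?thesis by simp
qed

lemma right_mults_filter:
  "v \<odot> ys = (v \<odot> filter P ys) \<odot> filter (\<lambda>y. \<not> P y) ys"
proof (induction ys arbitrary: v)
  case (Cons y ys)
  show ?case
    using Cons[of v] by (cases "P y") (simp_all add: right_mults_mult_commute)
qed simp

lemma right_nil_Un:
  assumes "right_nil k S" "right_nil l T"
  shows "right_nil (k + l) (S \<union> T)"
  unfolding right_nil_def
proof (intro allI impI, elim conjE)
  fix v ys
  assume ys: "set ys \<subseteq> S \<union> T" "length ys = k + l"
  let ?s = "filter (\<lambda>y. y \<in> S) ys" and ?t = "filter (\<lambda>y. y \<notin> S) ys"
  have split: "v \<odot> ys = (v \<odot> ?s) \<odot> ?t"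
    by (rule right_mults_filter)
  have "length ?s + length ?t = k + l"
    using sum_length_filter_compl[of "\<lambda>y. y \<in> S" ys] ys by simp
  then consider "k \<le> length ?s" | "l \<le> length ?t" by linarith
  then show "v \<odot> ys = 0"
  proof cases
    case 1
    then have "v \<odot> ?s = 0" by (intro right_nilD[OF assms(1)]) auto
    with split show ?thesis by simp
  next
    case 2
    then show ?thesis
      unfolding split using ys by (intro right_nilD[OF assms(2)]) auto
  qed
qed

lemma right_nil_UN:
  assumes "finite A" "\<And>a. a \<in> A \<Longrightarrow> \<exists>k. right_nil k (S a)"
  shows "\<exists>k. right_nil k (\<Union>a\<in>A. S a)"
  using assms
proof (induction rule: finite_induct)
  case empty
  have "right_nil 1 {}" by (simp add: right_nil_def)
  then show ?case by auto
next
  case (insert a A)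
  then obtain k l where "right_nil k (S a)" "right_nil l (\<Union>a\<in>A. S a)" by blast
  from right_nil_Un[OF this] show ?case by auto
qed

section \<open>Solvable subalgebras are right nil\<close>

text \<open>
  The product rule for one-element lists reads
  \<open>R\<^sub>x R\<^sub>y R\<^sub>z = R\<^bsub>xy\<^esub> R\<^sub>z + R\<^bsub>xz\<^esub> R\<^sub>y - R\<^bsub>(xy)z\<^esub>\<close>, and all three products on the right lie in
  \<open>B B\<close>.
\<close>

lemma right_nil_if_right_nil_square:
  assumes closed: "\<And>x y. x \<in> B \<Longrightarrow> y \<in> B \<Longrightarrow> x \<cdot> y \<in> B"
    and nil: "right_nil k (subspace_mult B B)"
  shows "right_nil (k * 3) B"
proof (rule right_nil_transfer[OF nil])
  fix v ys
  assume ys: "set ys \<subseteq> B" "length ys = 3"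
  then obtain x y z where xyz: "ys = [x, y, z]" "x \<in> B" "y \<in> B" "z \<in> B"
    by (auto simp: numeral_3_eq_3 length_Suc_conv)
  let ?I = "right_ideal_of v (subspace_mult B B)"
  have sq: "a \<cdot> b \<in> subspace_mult B B" if "a \<in> B" "b \<in> B" for a b
    using that unfolding subspace_mult_def by (blast intro: span_base)
  have "v \<cdot> (x \<cdot> y) \<cdot> z \<in> ?I" "v \<cdot> (x \<cdot> z) \<cdot> y \<in> ?I"
    using xyz sq right_ideal_of_generator[of "x \<cdot> y" "subspace_mult B B" v "[z]"]
      right_ideal_of_generator[of "x \<cdot> z" "subspace_mult B B" v "[y]"] by simp_all
  moreover have "v \<cdot> (x \<cdot> y \<cdot> z) \<in> ?I"
    using xyz sq closed by (intro right_ideal_of_generator') simp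
  moreover have "v \<odot> ys = v \<cdot> (x \<cdot> y) \<cdot> z + v \<cdot> (x \<cdot> z) \<cdot> y - v \<cdot> (x \<cdot> y \<cdot> z)"
    using mult_right_mults_append[of v x "[y]" "[z]"] xyz by (simp add: algebra_simps)
  ultimately show "v \<odot> ys \<in> ?I"
    using subspace_right_ideal_of by (simp add: subspace_add subspace_diff)
qed

lemma right_nil_of_derived_power:
  assumes "subspace B" "\<And>x y. x \<in> B \<Longrightarrow> y \<in> B \<Longrightarrow> x \<cdot> y \<in> B" "derived_power B m = {0}"
  shows "\<exists>k. right_nil k B"
  using assms
proof (induction m arbitrary: B)
  case 0
  then have "right_nil 1 B"
    by (auto simp: right_nil_def length_Suc_conv)
  then show ?case ..
next
  case (Suc m)
  have "subspace_mult B B \<subseteq> B"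
    unfolding subspace_mult_def using Suc.prems by (intro span_minimal) auto
  then have "x \<cdot> y \<in> subspace_mult B B"
    if "x \<in> subspace_mult B B" "y \<in> subspace_mult B B" for x y
    using that unfolding subspace_mult_def by (blast intro: span_base)
  moreover have "derived_power (subspace_mult B B) m = {0}"
    using Suc.prems(3) by (simp only: derived_power_Suc_left)
  moreover have "subspace (subspace_mult B B)"
    unfolding subspace_mult_def by (rule subspace_span)
  ultimately obtain k where "right_nil k (subspace_mult B B)"
    using Suc.IH by blast
  from right_nil_if_right_nil_square[OF Suc.prems(2) this] show ?case by blast
qed

section \<open>Homogeneous components\<close>

text \<open>
  The product rule over \<open>c\<close> blocks of length \<open>m\<close>: each block adds one term in the ideal and
  subtracts one copy of the full product. The coefficient is \<open>c - 1\<close>, and not \<open>c\<close>, because for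
  the empty list the two terms are both \<open>v \<cdot> x\<close> and must cancel.
\<close>

lemma right_mults_blocks:
  assumes block: "\<And>bs. set bs \<subseteq> T \<Longrightarrow> length bs = m \<Longrightarrow> x \<odot> bs \<in> S"
    and "set ys \<subseteq> T" "length ys = c * m"
  shows "v \<cdot> (x \<odot> ys) + (of_nat c - 1) *s ((v \<cdot> x) \<odot> ys) \<in> right_ideal_of v S"
  using assms(2,3)
proof (induction c arbitrary: ys)
  case 0
  then show ?case
    using subspace_0[OF subspace_right_ideal_of] by simp
next
  case (Suc c)
  define bs where "bs = take m ys"
  define zs where "zs = drop m ys"
  have ys: "ys = bs @ zs" by (simp add: bs_def zs_def)
  have bs: "set bs \<subseteq> T" "length bs = m" and zs: "set zs \<subseteq> T" "length zs = c * m"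
    using Suc.prems set_take_subset[of m ys] set_drop_subset[of m ys]
    by (auto simp: bs_def zs_def)
  let ?I = "right_ideal_of v S"
  have "(v \<cdot> (x \<odot> bs)) \<odot> zs \<in> ?I"
    using block[OF bs] by (rule right_ideal_of_generator)
  moreover have "(v \<cdot> (x \<odot> zs) + (of_nat c - 1) *s ((v \<cdot> x) \<odot> zs)) \<odot> bs \<in> ?I"
    using Suc.IH[OF zs] by (rule right_ideal_of_closed)
  ultimately have "(v \<cdot> (x \<odot> bs)) \<odot> zs
      + (v \<cdot> (x \<odot> zs) + (of_nat c - 1) *s ((v \<cdot> x) \<odot> zs)) \<odot> bs \<in> ?I"
    by (rule subspace_add[OF subspace_right_ideal_of])
  also have "(v \<cdot> (x \<odot> bs)) \<odot> zs
      + (v \<cdot> (x \<odot> zs) + (of_nat c - 1) *s ((v \<cdot> x) \<odot> zs)) \<odot> bs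
      = v \<cdot> (x \<odot> ys) + (of_nat (Suc c) - 1) *s ((v \<cdot> x) \<odot> ys)"
    using mult_right_mults_append[of v x bs zs]
    by (simp add: ys right_mults_add right_mults_diff right_mults_scale
        right_mults_commute[of _ zs bs] scale_left_diff_distrib)
  finally show ?case .
qed

end

lemma sum_const_UNIV_eq_0:
  fixes g :: "'g::{finite, ab_group_add}"
  shows "(\<Sum>h\<in>(UNIV :: 'g set). g) = 0"
proof -
  have "(\<Sum>h\<in>UNIV. h) = (\<Sum>h\<in>UNIV. g + h)"
    by (rule sum.reindex_bij_witness[of _ "\<lambda>h. g + h" "\<lambda>h. h - g"]) auto
  then show ?thesis
    by (simp add: sum.distrib)
qed

lemma sum_const_card_multiple_eq_0:
  fixes g :: "'g::{finite, ab_group_add}"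
  shows "(\<Sum>i<c * CARD('g). g) = 0"
proof (induction c)
  case (Suc c)
  have "(\<Sum>i<CARD('g). g) = (\<Sum>h\<in>(UNIV :: 'g set). g)"
  proof -
    obtain f where "bij_betw f {..<CARD('g)} (UNIV :: 'g set)"
      using ex_bij_betw_nat_finite[of "UNIV :: 'g set"] by (auto simp: atLeast0LessThan)
    then show ?thesis by (rule sum.reindex_bij_betw)
  qed
  moreover have "(\<Sum>i<Suc c * CARD('g). g) = (\<Sum>i<CARD('g). g) + (\<Sum>i<c * CARD('g). g)"
  proof -
    have "(\<Sum>i<a + b. g) = (\<Sum>i<a. g) + (\<Sum>i<b. g)" for a b :: nat
      by (induction b) (simp_all add: algebra_simps)
    then show ?thesis by simp
  qed
  ultimately show ?case
    using Suc by (simp add: sum_const_UNIV_eq_0)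
qed simp

locale graded_novikov_algebra =
  novikov_algebra scale mult + graded_algebra scale mult component
  for scale :: "'k::field \<Rightarrow> 'n::ab_group_add \<Rightarrow> 'n" (infixr \<open>*s\<close> 75)
    and mult :: "'n \<Rightarrow> 'n \<Rightarrow> 'n" (infixl \<open>\<cdot>\<close> 70)
    and component :: "'g::{finite, ab_group_add} \<Rightarrow> 'n set"
begin

lemma mult_component: "x \<in> component g \<Longrightarrow> y \<in> component h \<Longrightarrow> x \<cdot> y \<in> component (g + h)"
  using graded_mult[of g h] unfolding subspace_mult_def by (blast intro: span_base)

lemma right_mults_component:
  assumes "x \<in> component h" "set ys \<subseteq> component g"
  shows "x \<odot> ys \<in> component (h + (\<Sum>i<length ys. g))"
  using assms
proof (induction ys rule: rev_induct)
  case (snoc y ys)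
  then have "x \<odot> ys \<cdot> y \<in> component (h + (\<Sum>i<length ys. g) + g)"
    by (intro mult_component) auto
  then show ?case by (simp add: add.assoc)
qed simp

lemma right_mults_component_zero:
  assumes "x \<in> component g" "set ys \<subseteq> component g" "Suc (length ys) = c * CARD('g)"
  shows "x \<odot> ys \<in> component 0"
proof -
  have "g + (\<Sum>i<length ys. g) = (\<Sum>i<Suc (length ys). g)"
    by (simp add: add.commute)
  also have "\<dots> = 0"
    unfolding assms(3) by (rule sum_const_card_multiple_eq_0)
  finally show ?thesis
    using right_mults_component[OF assms(1,2)] by simp
qed

lemma right_nil_component:
  assumes nil: "right_nil k (component 0)" and invertible: "of_nat CARD('g) \<noteq> (0 :: 'k)"
  shows "right_nil (k * (CARD('g) * CARD('g))) (component g)"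
proof (rule right_nil_transfer[OF nil])
  let ?n = "CARD('g)"
  fix v ys
  assume ys: "set ys \<subseteq> component g" "length ys = ?n * ?n"
  have n: "?n > 0" by simp
  with ys obtain x zs where xzs: "ys = x # zs"
    by (metis length_greater_0_conv list.exhaust nat_0_less_mult_iff)
  then have x: "x \<in> component g" and zs: "set zs \<subseteq> component g" "Suc (length zs) = ?n * ?n"
    using ys by auto
  let ?I = "right_ideal_of v (component 0)"
  have "length zs = (?n + 1) * (?n - 1)"
    using zs(2) n by (cases ?n) (auto simp: algebra_simps)
  then have "v \<cdot> (x \<odot> zs) + (of_nat (?n + 1) - 1) *s ((v \<cdot> x) \<odot> zs) \<in> ?I"
    using x zs right_mults_component_zero[OF x, where c = 1]
    by (intro right_mults_blocks[where T = "component g" and m = "?n - 1"]) auto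
  moreover have "v \<cdot> (x \<odot> zs) \<in> ?I"
    using right_mults_component_zero[OF x zs] by (rule right_ideal_of_generator')
  ultimately have "v \<cdot> (x \<odot> zs) + of_nat ?n *s (v \<odot> ys) - v \<cdot> (x \<odot> zs) \<in> ?I"
    by (intro subspace_diff[OF subspace_right_ideal_of]) (simp_all add: xzs)
  then have "inverse (of_nat ?n) *s of_nat ?n *s (v \<odot> ys) \<in> ?I"
    by (simp add: subspace_scale[OF subspace_right_ideal_of] del: scale_scale)
  then show "v \<odot> ys \<in> ?I"
    unfolding scale_scale left_inverse[OF invertible] scale_one .
qed

lemma span_components: "span (\<Union>g. component g) = UNIV"
proof -
  have "x \<in> span (\<Union>g. component g)" for x
  proof -
    obtain f where "\<forall>g. f g \<in> component g" "x = (\<Sum>g\<in>UNIV. f g)"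
      using direct_sum[of x] by blast
    then show ?thesis by (force intro: span_sum span_base)
  qed
  then show ?thesis by blast
qed

lemma solvable_if_solvable_component_zero:
  assumes "solvable (component 0)" "of_nat CARD('g) \<noteq> (0 :: 'k)"
  shows "solvable UNIV"
proof -
  have "x \<cdot> y \<in> component 0" if "x \<in> component 0" "y \<in> component 0" for x y
    using mult_component[OF that] by simp
  then obtain k where "right_nil k (component 0)"
    using assms(1) right_nil_of_derived_power[OF subspace_component]
    unfolding solvable_def by blast
  then have "\<exists>k. right_nil k (component g)" for g
    using right_nil_component[OF _ assms(2)] by blast
  then obtain l where "right_nil l (\<Union>g. component g)"
    using right_nil_UN[of UNIV component] by auto
  then have "right_nil l UNIV"
    using right_nil_span span_components by metis
  then show ?thesis by (rule solvable_if_right_nil)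
qed

end

section \<open>Graded Novikov algebras with solvable zero component\<close>

theorem theorem2:
  fixes scale :: "'k::field \<Rightarrow> 'n::ab_group_add \<Rightarrow> 'n"
    and mult :: "'n \<Rightarrow> 'n \<Rightarrow> 'n"
    and N :: "'g::{finite, ab_group_add} \<Rightarrow> 'n set"
  assumes "novikov_algebra scale mult"
    and "graded_algebra scale mult N"
    and "nonassoc_algebra.solvable scale mult (N 0)"
    and "CHAR('k) = 0 \<or> \<not> CHAR('k) dvd CARD('g)"
  shows "nonassoc_algebra.solvable scale mult UNIV"
proof -
  interpret graded_novikov_algebra scale mult N
    using assms(1,2) by (simp add: graded_novikov_algebra_def graded_algebra_def)
  have "of_nat CARD('g) \<noteq> (0 :: 'k)"
    using assms(4) by (auto simp: of_nat_eq_0_iff_char_dvd)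
  with assms(3) show ?thesis
    by (rule solvable_if_solvable_component_zero)
qed

end
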